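(* Let $p,q>1$ satisfy $\frac1p+\frac1q=1$, and let $f,g\in C([0,1])$. Suppose that $\zeta_f^{(p)}\in\ell^p(\mathbb N_{-1})$, $\zeta_g^{(q)}\in\ell^q(\mathbb N_{-1})$, and $H_f\in\ell^p(\mathbb N_0)$. Then the mapping $$I_{f,g}^{\mathbb T}:\mathbb T\to\mathbb R,\qquad I_{f,g}^{\mathbb T}(t)=\int_0^t f\,dg:=\lim_{n\to\infty}S_n^L(t;f,g)$$ (these limits exist for every $t\in\mathbb T$) is uniformly continuous on $\mathbb T$. Thus it admits a unique continuous extension to $[0,1]$.
   Context: $C([0,1])$ denotes the real-valued continuous functions on $[0,1]$. $\mathbb N_0=\{0,1,2,\dots\}$, $\mathbb N_{-1}=\{-1,0,1,\dots\}$. For $n\in\mathbb N_0$: $t_{n,k}=k2^{-n}$ for $0\le k\le 2^n$, $\mathbb T_n=\{t_{n,k}:0\le k\le 2^n\}$, $\mathbb T=\bigcup_{n\ge0}\mathbb T_n$, $I_n=\{0,\dots,2^n-1\}$; for $t\in\mathbb T$, $\ell(t)=\min\{m\ge0:t\in\mathbb T_m\}$. Dyadic left sums: for $f,g\in C([0,1])$, $t\in\mathbb T$, $n\ge\ell(t)$, $$S_n^L(t;f,g)=\sum_{k=0}^{2^nt-1}f(t_{n,k})\big(g(t_{n,k+1})-g(t_{n,k})\big)$$ (empty sum $=0$). Faber--Schauder coefficients of $f\in C([0,1])$: $\theta^f_{-1,0}=f(1)-f(0)$, and for $n\ge0$, $k\in I_n$, $\theta^f_{n,k}=2^{n/2}\big(2f(t_{n+1,2k+1})-f(t_{n,k})-f(t_{n,k+1})\big)$.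 Level energies ($p>1$): $\zeta_f^{(p)}=(\zeta_f^{(p)}(n))_{n\in\mathbb N_{-1}}$ with $\zeta_f^{(p)}(-1)=2^{1-\frac1p}|\theta^f_{-1,0}|$ and $\zeta_f^{(p)}(n)=\big(2^{-np/2}\sum_{k\in I_n}|\theta^f_{n,k}|^p\big)^{1/p}$ for $n\ge0$. Schauder tail sequence: $H_f(n)=\sum_{m=n}^\infty 2^{-m/2}\sup_{k\in I_m}|\theta^f_{m,k}|\in[0,\infty]$ for $n\ge0$. *)

theory Defs
  imports "HOL-Analysis.Analysis"
begin

text \<open>
  Elements of \<open>C([0,1])\<close> are functions \<open>f :: real \<Rightarrow> real\<close> with \<^term>\<open>continuous_on {0..1} f\<close>;
  nothing below depends on values outside the unit interval.
\<close>

definition dyadic :: "nat \<Rightarrow> nat \<Rightarrow> real" where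
  "dyadic n k = real k / 2 ^ n"

definition dyadics_at :: "nat \<Rightarrow> real set" where
  "dyadics_at n = dyadic n ` {0..2 ^ n}"

definition unit_dyadics :: "real set" where
  "unit_dyadics = (\<Union>n. dyadics_at n)"

text \<open>
  Once \<open>t\<close> belongs to \<^term>\<open>dyadics_at n\<close> (hence for all but finitely many \<open>n\<close>, if \<open>t\<close> is dyadic),
  \<open>2 ^ n * t\<close> is a natural number and the floor does nothing.  The values for smaller \<open>n\<close>
  are a harmless convention, since only the limit in \<open>n\<close> is used.
\<close>
definition left_sum :: "(real \<Rightarrow> real) \<Rightarrow> (real \<Rightarrow> real) \<Rightarrow> nat \<Rightarrow> real \<Rightarrow> real" where
  "left_sum f g n t =
     (\<Sum>k<nat \<lfloor>2 ^ n * t\<rfloor>. f (dyadic n k) * (g (dyadic n (k + 1)) - g (dyadic n k)))"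

definition dyadic_integral :: "(real \<Rightarrow> real) \<Rightarrow> (real \<Rightarrow> real) \<Rightarrow> real \<Rightarrow> real" where
  "dyadic_integral f g t = lim (\<lambda>n. left_sum f g n t)"

text \<open>
  Levels are integers \<open>\<ge> -1\<close>.  At level \<open>-1\<close> only \<open>k = 0\<close> is meaningful, at level \<open>n \<ge> 0\<close> only
  \<open>k < 2 ^ n\<close>.
\<close>
definition faber_schauder_coeff :: "(real \<Rightarrow> real) \<Rightarrow> int \<Rightarrow> nat \<Rightarrow> real" where
  "faber_schauder_coeff f n k =
     (if n = -1 then f 1 - f 0
      else 2 powr (real_of_int n / 2) *
        (2 * f (dyadic (nat n + 1) (2 * k + 1)) - f (dyadic (nat n) k) - f (dyadic (nat n) (k + 1))))"

definition level_energy :: "real \<Rightarrow> (real \<Rightarrow> real) \<Rightarrow> int \<Rightarrow> real" where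
  "level_energy p f n =
     (if n = -1 then 2 powr (1 - 1 / p) * \<bar>faber_schauder_coeff f (-1) 0\<bar>
      else (2 powr (- (real_of_int n * p / 2)) *
        (\<Sum>k<2 ^ nat n. \<bar>faber_schauder_coeff f n k\<bar> powr p)) powr (1 / p))"

definition schauder_tail :: "(real \<Rightarrow> real) \<Rightarrow> nat \<Rightarrow> ennreal" where
  "schauder_tail f n =
     (\<Sum>\<^sub>\<infinity>m\<in>{n..}. ennreal (2 powr (- (real m / 2))) *
        (SUP k\<in>{..<2 ^ m}. ennreal \<bar>faber_schauder_coeff f (int m) k\<bar>))"

definition ell_p :: "real \<Rightarrow> 'i set \<Rightarrow> ('i \<Rightarrow> real) set" where
  "ell_p p A = {x. (\<lambda>i. \<bar>x i\<bar> powr p) summable_on A}"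

text \<open>
  Membership in \<open>\<ell>\<^sup>p\<close> for \<open>[0,\<infinity>]\<close>-valued sequences.  Finiteness has to be required
  explicitly because \<^term>\<open>enn2real \<infinity> = 0\<close>.
\<close>
definition ell_p_ennreal :: "real \<Rightarrow> 'i set \<Rightarrow> ('i \<Rightarrow> ennreal) set" where
  "ell_p_ennreal p A = {x. (\<forall>i\<in>A. x i \<noteq> \<infinity>) \<and> (\<lambda>i. enn2real (x i)) \<in> ell_p p A}"

end

theory Submission
  imports Defs
begin

text \<open>
  Halving a dyadic cell with end points \<open>l < r\<close> and midpoint \<open>m\<close> changes the left sum by
  \<open>(f m - f l) * (g r - g m)\<close>, a product of two increments of the next level.  Hence the
  left sums converge as soon as the products of increments are summable over all cells of all
  levels.  By Young's inequality it is enough that the energies \<open>\<Sum>\<^sub>k \<bar>\<Delta>\<^bsub>n,k\<^esub> f\<bar>\<^sup>p\<close> and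
  \<open>\<Sum>\<^sub>k \<bar>\<Delta>\<^bsub>n,k\<^esub> g\<bar>\<^sup>q\<close> of the \<^emph>\<open>first\<close> differences are summable in the level \<open>n\<close>.  The level
  energies in the hypotheses are built from \<^emph>\<open>second\<close> differences, since up to normalisation these
  are the Faber--Schauder coefficients.  But the increments over the two halves of a cell are \<open>(\<Delta> \<plusminus> d) / 2\<close>, with \<open>\<Delta>\<close>
  the increment and \<open>d\<close> the second difference of the cell; two terms of size
  \<open>\<bar>\<Delta> / 2\<bar>\<^sup>p\<close> add up to \<open>\<bar>\<Delta>\<bar>\<^sup>p\<close> times a factor smaller than \<open>1\<close> because \<open>p > 1\<close>, so passing to the next level contracts the first-difference
  energy up to a summable error (\<open>increment_energy_Suc_le\<close>, \<open>summable_increment_energy\<close>).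

  For continuity of the limit, left sums are extended from the dyadic points to all of \<open>[0,1]\<close> by
  stopping \<open>g\<close> at time \<open>t\<close>.  The stopped sums are continuous in \<open>t\<close>, and agree with the left sums
  at all dyadic points of their level.  Refining a stopped sum costs the same products as
  before, plus one incomplete cell, which contributes at most the largest increment of \<open>f\<close> at
  the next level times the oscillation of \<open>g\<close>.  These largest increments are summable over the
  levels because the Schauder tail of \<open>f\<close> is finite.  So the stopped sums converge uniformly on
  \<open>[0,1]\<close> (\<open>uniform_limit_stopped_sum\<close>), and their continuous limit is the required extension;
  uniqueness is density of the dyadic points.
\<close>

section \<open>Dyadic cells\<close>

definition increment :: "(real \<Rightarrow> real) \<Rightarrow> nat \<Rightarrow> nat \<Rightarrow> real" where
  "increment f n k = f (dyadic n (k + 1)) - f (dyadic n k)"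

definition second_difference :: "(real \<Rightarrow> real) \<Rightarrow> nat \<Rightarrow> nat \<Rightarrow> real" where
  "second_difference f n k =
     2 * f (dyadic (n + 1) (2 * k + 1)) - f (dyadic n k) - f (dyadic n (k + 1))"

lemma dyadic_Suc_even: "dyadic (Suc n) (2 * k) = dyadic n k"
  by (simp add: dyadic_def)

lemma dyadic_mono: "i \<le> j \<Longrightarrow> dyadic n i \<le> dyadic n j"
  by (simp add: dyadic_def divide_right_mono)

lemma dyadic_in_unit: "k \<le> 2 ^ n \<Longrightarrow> dyadic n k \<in> {0..1}"
  by (simp add: dyadic_def divide_le_eq of_nat_le_numeral_power_cancel_iff)

lemma dyadics_at_mono: "m \<le> n \<Longrightarrow> dyadics_at m \<subseteq> dyadics_at n"
proof (rule lift_Suc_mono_le[of dyadics_at])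
  fix n show "dyadics_at n \<subseteq> dyadics_at (Suc n)"
  proof
    fix t assume "t \<in> dyadics_at n"
    then obtain k where "k \<le> 2 ^ n" and "t = dyadic (Suc n) (2 * k)"
      unfolding dyadics_at_def dyadic_Suc_even by auto
    then show "t \<in> dyadics_at (Suc n)" by (simp add: dyadics_at_def)
  qed
qed

lemma unit_dyadics_subset: "unit_dyadics \<subseteq> {0..1}"
  using dyadic_in_unit by (auto simp: unit_dyadics_def dyadics_at_def)

lemma closure_unit_dyadics: "closure unit_dyadics = {0..1}"
proof
  show "closure unit_dyadics \<subseteq> {0..1}"
    by (intro closure_minimal unit_dyadics_subset closed_atLeastAtMost)
  show "{0..1} \<subseteq> closure unit_dyadics"
  proof
    fix t :: real assume t: "t \<in> {0..1}"
    define x where "x n = dyadic n (nat \<lfloor>2 ^ n * t\<rfloor>)" for n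
    have le: "t - 1 / 2 ^ n \<le> x n" "x n \<le> t" for n
    proof -
      have "real (nat \<lfloor>2 ^ n * t\<rfloor>) = of_int \<lfloor>2 ^ n * t\<rfloor>" using t by simp
      moreover have "of_int \<lfloor>2 ^ n * t\<rfloor> \<le> 2 ^ n * t" "2 ^ n * t < of_int \<lfloor>2 ^ n * t\<rfloor> + 1"
        by linarith+
      ultimately have "(2 ^ n * t - 1) / 2 ^ n \<le> x n" "x n \<le> 2 ^ n * t / 2 ^ n"
        unfolding x_def dyadic_def by (intro divide_right_mono; simp)+
      then show "t - 1 / 2 ^ n \<le> x n" "x n \<le> t"
        by (simp_all add: diff_divide_distrib)
    qed
    have "x n \<in> unit_dyadics" for n
    proof -
      have "2 ^ n * t \<le> 2 ^ n" using t by simp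
      then have "\<lfloor>2 ^ n * t\<rfloor> \<le> 2 ^ n" by (metis floor_mono floor_numeral_power floor_of_int of_int_numeral of_int_power)
      then have "nat \<lfloor>2 ^ n * t\<rfloor> \<le> 2 ^ n" by (simp add: nat_le_iff)
      then show ?thesis unfolding x_def unit_dyadics_def dyadics_at_def by force
    qed
    moreover have "x \<longlonglongrightarrow> t"
    proof (rule real_tendsto_sandwich)
      have "(\<lambda>n. t - (1 / 2) ^ n) \<longlonglongrightarrow> t - 0"
        by (intro tendsto_intros LIMSEQ_power_zero) simp
      then show "(\<lambda>n. t - 1 / 2 ^ n) \<longlonglongrightarrow> t" by (simp add: power_divide)
    qed (use le in auto)
    ultimately show "t \<in> closure unit_dyadics"
      unfolding closure_sequential by blast
  qed
qed

lemma increment_Suc: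
  shows "increment f (Suc n) (2 * k) = (increment f n k + second_difference f n k) / 2"
    and "increment f (Suc n) (2 * k + 1) = (increment f n k - second_difference f n k) / 2"
  using dyadic_Suc_even[of n k] dyadic_Suc_even[of n "k + 1"]
  by (simp_all add: increment_def second_difference_def field_simps)

lemma abs_increment_Suc_le:
  shows "2 * \<bar>increment f (Suc n) (2 * k)\<bar> \<le> \<bar>increment f n k\<bar> + \<bar>second_difference f n k\<bar>"
    and "2 * \<bar>increment f (Suc n) (2 * k + 1)\<bar> \<le> \<bar>increment f n k\<bar> + \<bar>second_difference f n k\<bar>"
  unfolding increment_Suc by (simp_all add: abs_triangle_ineq abs_triangle_ineq4)

lemma sum_Suc_level:
  "(\<Sum>k<2 ^ Suc n. h k) = (\<Sum>k<2 ^ n. h (2 * k) + h (2 * k + 1))" for h :: "nat \<Rightarrow> real"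
  using sum_split_even_odd[of h h "2 ^ n"] by (simp add: sum.distrib)

lemma faber_schauder_coeff_eq:
  "faber_schauder_coeff f (int n) k = 2 powr (real n / 2) * second_difference f n k"
  by (simp add: faber_schauder_coeff_def second_difference_def)

section \<open>Contraction of first differences\<close>

text \<open>
  Summing the recursion gives \<open>(1 - r) * (\<Sum>i<n. u i) \<le> u 0 + (\<Sum>i<n. e i)\<close> for all \<open>n\<close>.
\<close>
lemma summable_contracting_recursion:
  fixes u e :: "nat \<Rightarrow> real"
  assumes r: "r < 1" and u: "\<And>n. 0 \<le> u n" and e: "\<And>n. 0 \<le> e n"
    and rec: "\<And>n. u (Suc n) \<le> r * u n + e n" and "summable e"
  shows "summable u"
proof (rule summableI_nonneg_bounded[OF u])
  fix n
  have partial: "(\<Sum>i<n. u i) + u n \<le> u 0 + r * (\<Sum>i<n. u i) + (\<Sum>i<n. e i)" for n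
  proof (induction n)
    case (Suc n)
    with rec[of n] show ?case by (simp add: algebra_simps)
  qed simp
  have "(\<Sum>i<n. e i) \<le> suminf e"
    using \<open>summable e\<close> e by (intro sum_le_suminf) auto
  then have "(\<Sum>i<n. u i) * (1 - r) \<le> u 0 + suminf e"
    using u[of n] partial[of n] by (simp add: algebra_simps)
  then show "(\<Sum>i<n. u i) \<le> (u 0 + suminf e) / (1 - r)"
    using r by (simp add: pos_le_divide_eq)
qed

definition increment_energy :: "real \<Rightarrow> (real \<Rightarrow> real) \<Rightarrow> nat \<Rightarrow> real" where
  "increment_energy p f n = (\<Sum>k<2 ^ n. \<bar>increment f n k\<bar> powr p)"

lemma increment_energy_nonneg: "0 \<le> increment_energy p f n"
  by (simp add: increment_energy_def sum_nonneg)

lemma level_energy_powr: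
  assumes "p > 1"
  shows "\<bar>level_energy p f (int n)\<bar> powr p = (\<Sum>k<2 ^ n. \<bar>second_difference f n k\<bar> powr p)"
proof -
  let ?S = "\<Sum>k<2 ^ n. \<bar>faber_schauder_coeff f (int n) k\<bar> powr p"
  have "?S = 2 powr (real n * p / 2) * (\<Sum>k<2 ^ n. \<bar>second_difference f n k\<bar> powr p)"
    by (simp add: faber_schauder_coeff_eq abs_mult powr_mult powr_powr sum_distrib_left)
  then have "2 powr (- (real n * p / 2)) * ?S = (\<Sum>k<2 ^ n. \<bar>second_difference f n k\<bar> powr p)"
    by (simp add: powr_minus field_simps)
  then show ?thesis
    using assms by (simp add: level_energy_def powr_powr sum_nonneg)
qed

lemma powr_convex_combination_le:
  fixes a b l p :: real
  assumes "1 \<le> p" "0 \<le> a" "0 \<le> b" "0 \<le> l" "l \<le> 1"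
  shows "((1 - l) * a + l * b) powr p \<le> (1 - l) * a powr p + l * b powr p"
proof -
  have scale: "(c * x) powr p \<le> c * x powr p" if "0 \<le> c" "c \<le> 1" "0 \<le> x" for c x :: real
  proof -
    have "c powr p \<le> c"
      using that assms(1) powr_mono'[of 1 p c] by (cases "c = 0") auto
    then show ?thesis using that by (simp add: powr_mult mult_right_mono)
  qed
  show ?thesis
  proof (cases "a = 0 \<or> b = 0")
    case True
    then show ?thesis
      using scale[of "1 - l" a] scale[of l b] assms by auto
  next
    case False
    then show ?thesis
      using convex_onD[OF powr_convex[OF assms(1)], of l a b] assms by simp
  qed
qed

text \<open>
  The triangle inequality bounds \<open>\<bar>\<Delta> \<plusminus> d\<bar> / 2\<close> by the convex combination
  \<open>3/4 * (2/3 * \<bar>\<Delta>\<bar>) + 1/4 * (2 * \<bar>d\<bar>)\<close>.  Any weight strictly between \<open>1/2\<close> and \<open>1\<close> in place of \<open>3/4\<close> would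
  give a contraction factor below \<open>1\<close>.
\<close>
lemma increment_energy_Suc_le:
  assumes "p > 1"
  shows "increment_energy p f (Suc n) \<le> (2 / 3) powr (p - 1) * increment_energy p f n
     + 2 powr (p - 1) * (\<Sum>k<2 ^ n. \<bar>second_difference f n k\<bar> powr p)"
proof -
  have half: "\<bar>c\<bar> powr p \<le> ((2 / 3) powr (p - 1) * \<bar>a\<bar> powr p + 2 powr (p - 1) * \<bar>b\<bar> powr p) / 2"
    if "2 * \<bar>c\<bar> \<le> \<bar>a\<bar> + \<bar>b\<bar>" for a b c :: real
  proof -
    have "\<bar>c\<bar> powr p \<le> ((1 - 1 / 4) * (2 / 3 * \<bar>a\<bar>) + 1 / 4 * (2 * \<bar>b\<bar>)) powr p"
      using that assms by (intro powr_mono2) auto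
    also have "\<dots> \<le> (1 - 1 / 4) * (2 / 3 * \<bar>a\<bar>) powr p + 1 / 4 * (2 * \<bar>b\<bar>) powr p"
      using assms by (intro powr_convex_combination_le) auto
    also have "\<dots> = ((2 / 3) powr (p - 1) * \<bar>a\<bar> powr p + 2 powr (p - 1) * \<bar>b\<bar> powr p) / 2"
      unfolding powr_mult by (simp add: powr_diff field_simps)
    finally show ?thesis .
  qed
  have "increment_energy p f (Suc n)
      = (\<Sum>k<2 ^ n. \<bar>increment f (Suc n) (2 * k)\<bar> powr p + \<bar>increment f (Suc n) (2 * k + 1)\<bar> powr p)"
    unfolding increment_energy_def by (rule sum_Suc_level)
  also have "\<dots> \<le> (\<Sum>k<2 ^ n. (2 / 3) powr (p - 1) * \<bar>increment f n k\<bar> powr p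
      + 2 powr (p - 1) * \<bar>second_difference f n k\<bar> powr p)"
  proof (rule sum_mono)
    fix k
    show "\<bar>increment f (Suc n) (2 * k)\<bar> powr p + \<bar>increment f (Suc n) (2 * k + 1)\<bar> powr p
      \<le> (2 / 3) powr (p - 1) * \<bar>increment f n k\<bar> powr p
      + 2 powr (p - 1) * \<bar>second_difference f n k\<bar> powr p"
      using add_mono[OF half[OF abs_increment_Suc_le(1)[of f n k]]
          half[OF abs_increment_Suc_le(2)[of f n k]]]
      by (simp only: field_sum_of_halves)
  qed
  also have "\<dots> = (2 / 3) powr (p - 1) * increment_energy p f n
     + 2 powr (p - 1) * (\<Sum>k<2 ^ n. \<bar>second_difference f n k\<bar> powr p)"
    by (simp add: increment_energy_def sum.distrib sum_distrib_left)
  finally show ?thesis .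
qed

lemma summable_increment_energy:
  assumes "p > 1" and "level_energy p f \<in> ell_p p {-1..}"
  shows "summable (increment_energy p f)"
proof (rule summable_contracting_recursion)
  let ?E = "\<lambda>n. \<Sum>k<2 ^ n. \<bar>second_difference f n k\<bar> powr p"
  have "(\<lambda>i. \<bar>level_energy p f i\<bar> powr p) summable_on range int"
    using assms(2) by (auto simp: ell_p_def intro: summable_on_subset_banach)
  then have "(\<lambda>n. \<bar>level_energy p f (int n)\<bar> powr p) summable_on UNIV"
    by (subst (asm) summable_on_reindex) (auto simp: o_def)
  then have "summable ?E"
    unfolding level_energy_powr[OF assms(1)] by (rule summable_on_imp_summable)
  then show "summable (\<lambda>n. 2 powr (p - 1) * ?E n)"
    by (rule summable_mult)
  show "(2 / 3) powr (p - 1) < (1 :: real)"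
    using assms(1) powr_less_mono2[of "p - 1" "2 / 3" 1] by simp
qed (use increment_energy_Suc_le[OF assms(1)] in
    \<open>auto simp: increment_energy_nonneg intro!: mult_nonneg_nonneg sum_nonneg\<close>)

lemma summable_second_difference_bound:
  assumes "schauder_tail f 0 \<noteq> \<infinity>"
  obtains a where "summable a" and "\<And>n k. k < 2 ^ n \<Longrightarrow> \<bar>second_difference f n k\<bar> \<le> a n"
proof
  define b where "b m = ennreal (2 powr (- (real m / 2))) *
        (SUP k\<in>{..<2 ^ m}. ennreal \<bar>faber_schauder_coeff f (int m) k\<bar>)" for m
  have tail: "schauder_tail f 0 = (SUP F\<in>{F. finite F \<and> F \<subseteq> {0..}}. sum b F)"
    unfolding schauder_tail_def b_def by (rule nonneg_infsum_complete) simp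
  have le: "sum b F \<le> schauder_tail f 0" if "finite F" for F
    unfolding tail by (rule SUP_upper) (use that in auto)
  have fin: "b m < \<infinity>" for m
    using le[of "{m}"] assms by (simp add: less_top order_le_less_trans)
  show "summable (\<lambda>m. enn2real (b m))"
  proof (rule summableI_nonneg_bounded)
    fix n
    have "(\<Sum>i<n. enn2real (b i)) = enn2real (\<Sum>i<n. b i)"
      using fin by (subst enn2real_sum) auto
    also have "\<dots> \<le> enn2real (schauder_tail f 0)"
      using le[of "{..<n}"] assms by (intro enn2real_mono) (auto simp: less_top)
    finally show "(\<Sum>i<n. enn2real (b i)) \<le> enn2real (schauder_tail f 0)" .
  qed simp
  show "\<bar>second_difference f n k\<bar> \<le> enn2real (b n)" if "k < 2 ^ n" for n k
  proof -
    have "ennreal \<bar>second_difference f n k\<bar>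
        = ennreal (2 powr (- (real n / 2))) * ennreal \<bar>faber_schauder_coeff f (int n) k\<bar>"
      by (simp add: faber_schauder_coeff_eq abs_mult powr_minus flip: ennreal_mult)
    also have "\<dots> \<le> b n"
      unfolding b_def by (intro mult_left_mono SUP_upper) (use that in auto)
    finally show ?thesis
      using fin[of n] by (metis abs_ge_zero enn2real_ennreal enn2real_mono infinity_ennreal_def)
  qed
qed

text \<open>
  In the maximum norm the halving of cells contracts by the factor \<open>1/2\<close>.  The bound \<open>A\<close> is
  constructed by solving this recursion with equality.
\<close>
lemma summable_increment_bound:
  assumes "schauder_tail f 0 \<noteq> \<infinity>"
  obtains A where "summable A" and "\<And>n k. k < 2 ^ n \<Longrightarrow> \<bar>increment f n k\<bar> \<le> A n"
proof -
  obtain a where a: "summable a" "\<And>n k. k < 2 ^ n \<Longrightarrow> \<bar>second_difference f n k\<bar> \<le> a n"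
    using summable_second_difference_bound[OF assms] by blast
  have a0: "0 \<le> a n" for n
    using a(2)[of 0 n] by simp
  define A where "A = rec_nat \<bar>f 1 - f 0\<bar> (\<lambda>n x. (x + a n) / 2)"
  have A0: "A 0 = \<bar>f 1 - f 0\<bar>" and AS: "A (Suc n) = (A n + a n) / 2" for n
    by (simp_all add: A_def)
  have nonneg: "0 \<le> A n" for n
    by (induction n) (use a0 in \<open>auto simp: A0 AS\<close>)
  have "summable A"
  proof (rule summable_contracting_recursion)
    show "A (Suc n) \<le> 1 / 2 * A n + a n / 2" for n
      by (simp add: AS field_simps)
  qed (use nonneg a0 a(1) in auto)
  moreover have "\<bar>increment f n k\<bar> \<le> A n" if "k < 2 ^ n" for n k
    using that
  proof (induction n arbitrary: k)
    case 0
    then show ?case by (simp add: increment_def dyadic_def A0)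
  next
    case (Suc n)
    define j where "j = k div 2"
    have j: "j < 2 ^ n" and k: "k = 2 * j \<or> k = 2 * j + 1"
      using Suc.prems by (auto simp: j_def)
    have "\<bar>increment f (Suc n) k\<bar> \<le> (\<bar>increment f n j\<bar> + \<bar>second_difference f n j\<bar>) / 2"
      using k abs_increment_Suc_le[of f n j] by auto
    also have "\<dots> \<le> A (Suc n)"
      using Suc.IH[OF j] a(2)[OF j] by (simp add: AS)
    finally show ?case .
  qed
  ultimately show thesis by (rule that)
qed

section \<open>Stopped sums\<close>

text \<open>
  As a function of \<open>t\<close> this sum is continuous as soon as \<open>g\<close> is, whereas a sum whose range depends
  on \<open>t\<close> jumps when \<open>t\<close> crosses a dyadic point.
\<close>
definition stopped_sum :: "(real \<Rightarrow> real) \<Rightarrow> (real \<Rightarrow> real) \<Rightarrow> nat \<Rightarrow> real \<Rightarrow> real" where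
  "stopped_sum f g n t =
     (\<Sum>k<2 ^ n. f (dyadic n k) * (g (min t (dyadic n (k + 1))) - g (min t (dyadic n k))))"

text \<open>
  At a grid point no cell is cut: the cells to its left are complete, and on those to its right
  the stopped increment of \<open>g\<close> vanishes.
\<close>
lemma stopped_sum_eq_left_sum:
  assumes "t \<in> dyadics_at n"
  shows "stopped_sum f g n t = left_sum f g n t"
proof -
  obtain j where j: "t = dyadic n j" "j \<le> 2 ^ n"
    using assms by (auto simp: dyadics_at_def)
  have "2 ^ n * t = real j" by (simp add: j dyadic_def)
  then have "nat \<lfloor>2 ^ n * t\<rfloor> = j" by simp
  then have "left_sum f g n t = (\<Sum>k<j. f (dyadic n k) * (g (dyadic n (k + 1)) - g (dyadic n k)))"
    by (simp add: left_sum_def)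
  also have "\<dots> = (\<Sum>k<j. f (dyadic n k) * (g (min t (dyadic n (k + 1))) - g (min t (dyadic n k))))"
    using dyadic_mono[of _ j n] by (intro sum.cong) (auto simp: j min_absorb2)
  also have "\<dots> = stopped_sum f g n t"
    unfolding stopped_sum_def
    using j(2) dyadic_mono[of j _ n] by (intro sum.mono_neutral_left) (auto simp: j(1) min_absorb1)
  finally show ?thesis by simp
qed

lemma continuous_on_stopped_sum:
  assumes "continuous_on {0..1} g"
  shows "continuous_on {0..1} (stopped_sum f g n)"
proof -
  have "continuous_on {0..1} (\<lambda>t. g (min t (dyadic n k)))" if "k \<le> 2 ^ n" for k
    using dyadic_in_unit[OF that]
    by (intro continuous_on_compose2[OF assms] continuous_intros) (auto simp: min_def)
  then show ?thesis
    unfolding stopped_sum_def by (intro continuous_intros) auto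
qed

text \<open>
  On each cell refinement changes the integrand only over the right half, from the value of \<open>f\<close> at
  the left end point to its value at the midpoint.
\<close>
lemma stopped_sum_refine:
  "stopped_sum f g (Suc n) t - stopped_sum f g n t =
     (\<Sum>k<2 ^ n. increment f (Suc n) (2 * k) *
        (g (min t (dyadic (Suc n) (2 * k + 2))) - g (min t (dyadic (Suc n) (2 * k + 1)))))"
proof -
  have right: "dyadic (Suc n) (2 * k + 2) = dyadic n (k + 1)" for k
    using dyadic_Suc_even[of n "k + 1"] by simp
  have "stopped_sum f g (Suc n) t = (\<Sum>k<2 ^ n.
      f (dyadic n k) * (g (min t (dyadic (Suc n) (2 * k + 1))) - g (min t (dyadic n k)))
      + f (dyadic (Suc n) (2 * k + 1))
        * (g (min t (dyadic n (k + 1))) - g (min t (dyadic (Suc n) (2 * k + 1)))))"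
    unfolding stopped_sum_def sum_Suc_level
    by (simp only: add.assoc one_add_one right dyadic_Suc_even)
  then have "stopped_sum f g (Suc n) t - stopped_sum f g n t = (\<Sum>k<2 ^ n.
      (f (dyadic n k) * (g (min t (dyadic (Suc n) (2 * k + 1))) - g (min t (dyadic n k)))
      + f (dyadic (Suc n) (2 * k + 1))
        * (g (min t (dyadic n (k + 1))) - g (min t (dyadic (Suc n) (2 * k + 1)))))
      - f (dyadic n k) * (g (min t (dyadic n (k + 1))) - g (min t (dyadic n k))))"
    unfolding stopped_sum_def[of f g n] by (simp only: sum_subtractf)
  also have "\<dots> = (\<Sum>k<2 ^ n. increment f (Suc n) (2 * k) *
        (g (min t (dyadic (Suc n) (2 * k + 2))) - g (min t (dyadic (Suc n) (2 * k + 1)))))"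
    unfolding increment_def right dyadic_Suc_even by (simp only: algebra_simps) simp
  finally show ?thesis .
qed

text \<open>
  Stopping affects only the cell that contains \<open>t\<close>: a cell to the left of \<open>t\<close> contributes its full
  increment, a cell to the right of \<open>t\<close> nothing.
\<close>
lemma abs_stopped_increment_le:
  assumes t: "0 \<le> t" "t \<le> 1" and k: "k < 2 ^ n" and M: "\<And>x. x \<in> {0..1} \<Longrightarrow> \<bar>g x\<bar> \<le> M"
  shows "\<bar>g (min t (dyadic (Suc n) (2 * k + 2))) - g (min t (dyadic (Suc n) (2 * k + 1)))\<bar>
    \<le> \<bar>increment g (Suc n) (2 * k + 1)\<bar> + (if k = nat \<lfloor>2 ^ n * t\<rfloor> then 2 * M else 0)"
proof -
  let ?m = "dyadic (Suc n) (2 * k + 1)" and ?r = "dyadic (Suc n) (2 * k + 2)"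
  have "0 \<le> M" using M[of 0] by simp
  consider "?r \<le> t" | "t \<le> ?m" | "?m < t" "t < ?r" by linarith
  then show ?thesis
  proof cases
    case 1
    moreover have "?m \<le> ?r" by (rule dyadic_mono) simp
    ultimately show ?thesis
      using \<open>0 \<le> M\<close> by (simp add: min_absorb2 increment_def)
  next
    case 2
    moreover have "?m \<le> ?r" by (rule dyadic_mono) simp
    ultimately show ?thesis
      using \<open>0 \<le> M\<close> by (simp add: min_absorb1)
  next
    case 3
    have "\<lfloor>2 ^ n * t\<rfloor> = int k"
      using 3 by (intro floor_unique) (simp_all add: dyadic_def field_simps)
    then have eq: "k = nat \<lfloor>2 ^ n * t\<rfloor>" by simp
    have "?m \<in> {0..1}" using k by (intro dyadic_in_unit) simp
    then have "\<bar>g t - g ?m\<bar> \<le> 2 * M"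
      using M[of t] M[of ?m] t by simp
    with 3 eq show ?thesis by simp
  qed
qed

text \<open>
  Young's inequality handles the complete cells; the single cell containing \<open>t\<close> accounts for the
  last summand.
\<close>
lemma stopped_sum_refine_bound:
  assumes pq: "p > 1" "q > 1" "1 / p + 1 / q = 1"
    and t: "t \<in> {0..1}" and M: "\<And>x. x \<in> {0..1} \<Longrightarrow> \<bar>g x\<bar> \<le> M"
    and A: "\<And>k. k < 2 ^ Suc n \<Longrightarrow> \<bar>increment f (Suc n) k\<bar> \<le> a"
  shows "\<bar>stopped_sum f g (Suc n) t - stopped_sum f g n t\<bar>
    \<le> increment_energy p f (Suc n) / p + increment_energy q g (Suc n) / q + a * (2 * M)"
proof -
  have M0: "0 \<le> M" using M[of 0] by simp
  have a0: "0 \<le> a" using A[of 0] by simp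
  let ?k = "nat \<lfloor>2 ^ n * t\<rfloor>"
  let ?D = "\<lambda>k. increment f (Suc n) (2 * k) *
        (g (min t (dyadic (Suc n) (2 * k + 2))) - g (min t (dyadic (Suc n) (2 * k + 1))))"
  let ?P = "\<lambda>k. \<bar>increment f (Suc n) k\<bar> powr p / p + \<bar>increment g (Suc n) k\<bar> powr q / q"
  have P0: "0 \<le> ?P k" for k using pq by simp
  have "\<bar>?D k\<bar> \<le> (?P (2 * k) + ?P (2 * k + 1)) + (if k = ?k then a * (2 * M) else 0)"
    if k: "k < 2 ^ n" for k
  proof -
    let ?x = "\<bar>increment f (Suc n) (2 * k)\<bar>" and ?y = "\<bar>increment g (Suc n) (2 * k + 1)\<bar>"
    have "\<bar>?D k\<bar> \<le> ?x * (?y + (if k = ?k then 2 * M else 0))"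
      unfolding abs_mult using t k M
      by (intro mult_left_mono abs_stopped_increment_le) auto
    also have "\<dots> = ?x * ?y + (if k = ?k then ?x * (2 * M) else 0)"
      by (simp add: distrib_left)
    also have "\<dots> \<le> ?x * ?y + (if k = ?k then a * (2 * M) else 0)"
      using A[of "2 * k"] k M0 by (auto intro!: mult_right_mono)
    also have "?x * ?y \<le> ?x powr p / p + ?y powr q / q"
      using pq by (intro Youngs_inequality) auto
    \<comment> \<open>The missing half-cell terms are filled in, so that the sum over \<open>k\<close> becomes a full energy.\<close>
    also have "\<dots> \<le> ?P (2 * k) + ?P (2 * k + 1)"
      using pq by simp
    finally show ?thesis by simp
  qed
  then have "\<bar>\<Sum>k<2 ^ n. ?D k\<bar>
      \<le> (\<Sum>k<2 ^ n. (?P (2 * k) + ?P (2 * k + 1)) + (if k = ?k then a * (2 * M) else 0))"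
    by (intro order_trans[OF sum_abs] sum_mono) auto
  also have "\<dots> = (\<Sum>k<2 ^ Suc n. ?P k) + (\<Sum>k<2 ^ n. if k = ?k then a * (2 * M) else 0)"
    unfolding sum_Suc_level by (rule sum.distrib)
  also have "(\<Sum>k<2 ^ n. if k = ?k then a * (2 * M) else 0) \<le> a * (2 * M)"
    using a0 M0 by simp
  also have "(\<Sum>k<2 ^ Suc n. ?P k)
      = increment_energy p f (Suc n) / p + increment_energy q g (Suc n) / q"
    unfolding increment_energy_def by (simp only: sum.distrib sum_divide_distrib)
  finally show ?thesis
    unfolding stopped_sum_refine by simp
qed

lemma uniform_limit_stopped_sum:
  assumes pq: "p > 1" "q > 1" "1 / p + 1 / q = 1"
    and g: "continuous_on {0..1} g"
    and U: "summable (increment_energy p f)" and V: "summable (increment_energy q g)"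
    and tail: "schauder_tail f 0 \<noteq> \<infinity>"
  obtains F where "uniform_limit {0..1} (stopped_sum f g) F sequentially"
proof -
  obtain M where M: "\<And>x. x \<in> {0..1} \<Longrightarrow> \<bar>g x\<bar> \<le> M"
    using compact_imp_bounded[OF compact_continuous_image[OF g compact_Icc]]
    unfolding bounded_iff real_norm_def by (metis imageI)
  obtain A where A: "summable A" "\<And>n k. k < 2 ^ n \<Longrightarrow> \<bar>increment f n k\<bar> \<le> A n"
    using summable_increment_bound[OF tail] by blast
  let ?D = "\<lambda>n t. stopped_sum f g (Suc n) t - stopped_sum f g n t"
  have "summable (\<lambda>n. increment_energy p f (Suc n) / p + increment_energy q g (Suc n) / q
      + A (Suc n) * (2 * M))"
    using U V A(1)
    by (intro summable_add summable_mult2 summable_divide) (simp_all only: summable_Suc_iff)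
  then have "uniform_limit {0..1} (\<lambda>n t. \<Sum>i<n. ?D i t) (\<lambda>t. \<Sum>i. ?D i t) sequentially"
    by (rule Weierstrass_m_test[rotated])
      (use stopped_sum_refine_bound[OF pq _ M A(2)] in simp)
  then have "uniform_limit {0..1} (\<lambda>n t. (\<Sum>i<n. ?D i t) + stopped_sum f g 0 t)
      (\<lambda>t. (\<Sum>i. ?D i t) + stopped_sum f g 0 t) sequentially"
    by (intro uniform_limit_intros)
  moreover have "(\<Sum>i<n. ?D i t) + stopped_sum f g 0 t = stopped_sum f g n t" for n t
    using sum_lessThan_telescope[of "\<lambda>n. stopped_sum f g n t" n] by simp
  ultimately show thesis
    by (intro that) simp
qed

section \<open>The dyadic integral\<close>

theorem theorem3p7:
  fixes p q :: real and f g :: "real \<Rightarrow> real"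
  assumes "p > 1" and "q > 1" and "1 / p + 1 / q = 1"
    and "continuous_on {0..1} f" and "continuous_on {0..1} g"
    and "level_energy p f \<in> ell_p p {-1..}"
    and "level_energy q g \<in> ell_p q {-1..}"
    and "schauder_tail f \<in> ell_p_ennreal p UNIV"
  shows "(\<forall>t\<in>unit_dyadics. convergent (\<lambda>n. left_sum f g n t)) \<and>
    uniformly_continuous_on unit_dyadics (dyadic_integral f g) \<and>
    (\<exists>!F. F \<in> extensional {0..1} \<and> continuous_on {0..1} F \<and>
      (\<forall>t\<in>unit_dyadics. F t = dyadic_integral f g t))"
proof (intro conjI)
  have "schauder_tail f 0 \<noteq> \<infinity>"
    using assms(8) by (simp add: ell_p_ennreal_def)
  then obtain F where F: "uniform_limit {0..1} (stopped_sum f g) F sequentially"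
    using uniform_limit_stopped_sum[OF assms(1-3,5)] summable_increment_energy assms by metis
  have contF: "continuous_on {0..1} F"
    using continuous_on_stopped_sum[OF assms(5)]
    by (intro uniform_limit_theorem[OF _ F] always_eventually) auto
  have lim: "(\<lambda>n. left_sum f g n t) \<longlonglongrightarrow> F t" if t: "t \<in> unit_dyadics" for t
  proof -
    obtain m where "t \<in> dyadics_at m" using t by (auto simp: unit_dyadics_def)
    then have "\<forall>\<^sub>F n in sequentially. stopped_sum f g n t = left_sum f g n t"
      using dyadics_at_mono
      by (intro eventually_sequentiallyI[of m] stopped_sum_eq_left_sum) blast
    moreover have "(\<lambda>n. stopped_sum f g n t) \<longlonglongrightarrow> F t"
      using tendsto_uniform_limitI[OF F] t unit_dyadics_subset by blast
    ultimately show ?thesis by (rule Lim_transform_eventually[rotated])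
  qed
  then have eqF: "dyadic_integral f g t = F t" if "t \<in> unit_dyadics" for t
    using that by (simp add: dyadic_integral_def limI)
  show "\<forall>t\<in>unit_dyadics. convergent (\<lambda>n. left_sum f g n t)"
    using lim by (auto simp: convergent_def)
  have "uniformly_continuous_on unit_dyadics F"
    using compact_uniformly_continuous[OF contF compact_Icc] unit_dyadics_subset
    unfolding uniformly_continuous_on_def by (meson subsetD)
  then show "uniformly_continuous_on unit_dyadics (dyadic_integral f g)"
    using eqF by (simp add: uniformly_continuous_on_def)
  show "\<exists>!F. F \<in> extensional {0..1} \<and> continuous_on {0..1} F \<and>
      (\<forall>t\<in>unit_dyadics. F t = dyadic_integral f g t)"
  proof (intro ex1I[of _ "restrict F {0..1}"] conjI ballI)
    show "continuous_on {0..1} (restrict F {0..1})"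
      using contF by (subst continuous_on_cong[OF refl, of _ _ F]) auto
    show "restrict F {0..1} t = dyadic_integral f g t" if "t \<in> unit_dyadics" for t
      using that unit_dyadics_subset eqF by auto
  next
    fix G assume G: "G \<in> extensional {0..1} \<and> continuous_on {0..1} G \<and>
      (\<forall>t\<in>unit_dyadics. G t = dyadic_integral f g t)"
    have cont: "continuous_on (closure unit_dyadics) (\<lambda>t. G t - F t)"
      unfolding closure_unit_dyadics using G contF by (intro continuous_on_diff) auto
    have zero: "G t - F t = 0" if "t \<in> unit_dyadics" for t
      using G eqF[OF that] that by simp
    have "G t - F t = 0" if "t \<in> {0..1}" for t
      by (rule continuous_constant_on_closure[OF cont zero, unfolded closure_unit_dyadics, OF _ that])
    then have eq: "G t = restrict F {0..1} t" if "t \<in> {0..1}" for t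
      using that by (metis eq_iff_diff_eq_0 restrict_apply')
    show "G = restrict F {0..1}"
      by (rule extensionalityI[OF conjunct1[OF G] restrict_extensional eq])
  qed simp
qed

end
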